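(* Let $P=(P,\le_P)$ be a finite poset and let $X$ be an ideal in $(\mathcal{C}(P),\preceq)$. Then either there exist $n_0$ and a constant $d$ such that $|X_n|=d$ for all $n>n_0$, or $|X_n|\ge n$ for all $n\ge 1$.
   Context: For a finite poset $P=(P,\le_P)$, $\mathcal{C}(P)$ is the set of all pairs $(n,\chi)$ with $n\in\mathbb{N}_0$ and $\chi:\binom{[n]}{2}\to P$ (edge $P$-colored complete graphs on $[n]=\{1,\dots,n\}$). We write $(m,\psi)\preceq(n,\chi)$ iff there is an increasing map $f:[m]\to[n]$ with $\psi(\{i,j\})\le_P\chi(\{f(i),f(j)\})$ for all $1\le i<j\le m$. An ideal is a subset $X\subseteq\mathcal{C}(P)$ such that $K\preceq L\in X$ implies $K\in X$. $X_n=\{(n,\chi)\in X\}$. *)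

theory Defs
  imports Main "HOL-Library.FuncSet" "HOL-Library.Ramsey"
begin

text \<open>
  A poset is given by a carrier \<open>P\<close> and a relation \<open>r\<close> with \<open>partial_order_on P r\<close>,
  so that the empty poset is included; \<open>(x, y) \<in> r\<close> means $x \le_P y$.

  Colorings are extensional (\<open>undefined\<close> outside the 2-subsets of \<open>{1..n}\<close>), so that each map
  from the edges of the complete graph on \<open>{1..n}\<close> to \<open>P\<close> is represented by exactly one HOL
  function and cardinalities are correct.
\<close>

type_synonym 'a colored_graph = "nat \<times> (nat set \<Rightarrow> 'a)"

definition colored_graphs :: "'a set \<Rightarrow> 'a colored_graph set" where
  "colored_graphs P = {(n, \<chi>). \<chi> \<in> nsets {1..n} 2 \<rightarrow>\<^sub>E P}"

text \<open>
  Increasing means strictly increasing: \<open>{f i, f j}\<close> has to be an edge.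
\<close>

definition contained :: "('a \<times> 'a) set \<Rightarrow> 'a colored_graph \<Rightarrow> 'a colored_graph \<Rightarrow> bool" where
  "contained r = (\<lambda>(m, \<psi>) (n, \<chi>).
     \<exists>f. f \<in> {1..m} \<rightarrow> {1..n} \<and> strict_mono_on {1..m} f \<and>
         (\<forall>i j. 1 \<le> i \<and> i < j \<and> j \<le> m \<longrightarrow> (\<psi> {i, j}, \<chi> {f i, f j}) \<in> r))"

definition graph_ideal :: "'a set \<Rightarrow> ('a \<times> 'a) set \<Rightarrow> 'a colored_graph set \<Rightarrow> bool" where
  "graph_ideal P r X \<longleftrightarrow>
     X \<subseteq> colored_graphs P \<and>
     (\<forall>K \<in> colored_graphs P. \<forall>L \<in> X. contained r K L \<longrightarrow> K \<in> X)"

definition level :: "'a colored_graph set \<Rightarrow> nat \<Rightarrow> 'a colored_graph set" where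
  "level X n = {K \<in> X. fst K = n}"

end

theory Submission
  imports Defs
begin

text \<open>
  Only reflexivity of the order matters: an ideal is closed under passing to induced subgraphs.
  Suppose that level $n$ has fewer than $n$ elements.  If a vertex \<open>u\<close> sends one
  color to $n$ vertices to its right and another color to a later vertex \<open>t\<close>, then moving \<open>t\<close>
  through these vertices produces $n$ different induced subgraphs of order $n$.  Hence, by the
  pigeonhole principle, every vertex sends a single color to all vertices that are neither near to it
  nor near to the ends; the same holds to the left.  Therefore two vertices of the middle
  part that are far apart span an edge of a fixed color \<open>c\<close>, and so do two that are
  close to each other, since an edge of a different color could be slid along a sparse sequence of
  vertices.  So the middle vertices are twins, and deleting one of them is an injection from each
  large level to the previous one.
\<close>

section \<open>Induced subgraphs, and auxiliary facts on naturals\<close>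

definition pullback :: "nat \<Rightarrow> (nat \<Rightarrow> nat) \<Rightarrow> (nat set \<Rightarrow> 'a) \<Rightarrow> nat set \<Rightarrow> 'a" where
  "pullback n g \<chi> = restrict (\<lambda>e. \<chi> (g ` e)) (nsets {1..n} 2)"

lemma pullback_edge:
  assumes "1 \<le> i" "i < j" "j \<le> n"
  shows "pullback n g \<chi> {i, j} = \<chi> {g i, g j}"
  using assms by (simp add: pullback_def nsets_def)

lemma edges_cases:
  fixes e :: "nat set"
  assumes "e \<in> nsets {1..n} 2"
  obtains i j where "1 \<le> i" "i < j" "j \<le> n" "e = {i, j}"
proof -
  obtain x y where xy: "e = {x, y}" "x \<noteq> y"
    using assms by (auto simp: nsets_def card_2_iff)
  then have "x \<in> {1..n}" "y \<in> {1..n}"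
    using assms by (auto simp: nsets_def)
  with xy that[of x y] that[of y x] show ?thesis
    by (cases "x < y") (auto simp: insert_commute)
qed

lemma pullback_in_colored_graphs:
  assumes "(N, \<chi>) \<in> colored_graphs P" "g \<in> {1..n} \<rightarrow> {1..N}" "strict_mono_on {1..n} g"
  shows "(n, pullback n g \<chi>) \<in> colored_graphs P"
proof -
  have "\<chi> (g ` e) \<in> P" if "e \<in> nsets {1..n} 2" for e
  proof -
    obtain i j where ij: "1 \<le> i" "i < j" "j \<le> n" "e = {i, j}"
      using \<open>e \<in> nsets {1..n} 2\<close> by (rule edges_cases)
    then have "g i < g j"
      using assms(3) by (auto simp: strict_mono_on_def)
    moreover have "g i \<in> {1..N}" "g j \<in> {1..N}"
      using assms(2) ij by auto
    ultimately have "g ` e \<in> nsets {1..N} 2"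
      using ij by (auto simp: nsets_def)
    then show ?thesis
      using assms(1) by (auto simp: colored_graphs_def)
  qed
  then show ?thesis
    by (auto simp: colored_graphs_def pullback_def)
qed

lemma strict_mono_enumeration:
  fixes S :: "nat set"
  assumes "finite S" "n \<le> card S"
  obtains h where "\<And>k. k < n \<Longrightarrow> h k \<in> S" "\<And>k l. k < l \<Longrightarrow> l < n \<Longrightarrow> h k < h l"
proof
  let ?h = "\<lambda>k. sorted_list_of_set S ! k"
  show "?h k \<in> S" if "k < n" for k
    using that assms nth_mem[of k "sorted_list_of_set S"] by simp
  show "?h k < ?h l" if "k < l" "l < n" for k l
    using that assms strict_sorted_list_of_set[of S] by (simp add: sorted_wrt_nth_less)
qed

text \<open>The least value from \<open>N0\<close> on is attained at some point, and the sequence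
  can never leave it again.\<close>

lemma antimono_nat_eventually_const:
  fixes f :: "nat \<Rightarrow> nat"
  assumes "\<And>N. N \<ge> N0 \<Longrightarrow> f (Suc N) \<le> f N"
  shows "\<exists>n0 d. \<forall>n > n0. f n = d"
proof -
  obtain n1 where n1: "n1 \<ge> N0" "\<And>m. m \<ge> N0 \<Longrightarrow> f n1 \<le> f m"
    using ex_has_least_nat[of "\<lambda>m. m \<ge> N0" N0 f] by auto
  have "f m \<le> f n1" if "m \<ge> n1" for m
    using that
  proof (induction m rule: dec_induct)
    case (step k)
    have "f (Suc k) \<le> f k"
      using assms n1(1) step.hyps(1) by simp
    then show ?case
      using step.IH by (rule order_trans)
  qed simp
  then have "\<forall>m > n1. f m = f n1"
    using n1 by (simp add: order.antisym)
  then show ?thesis by blast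
qed

section \<open>Counting induced subgraphs in a hereditary class\<close>

locale hereditary_class =
  fixes P :: "'a set" and X :: "'a colored_graph set"
  assumes finite_colors: "finite P"
    and graphs: "X \<subseteq> colored_graphs P"
    and hereditary: "\<lbrakk>(N, \<chi>) \<in> X; g \<in> {1..n} \<rightarrow> {1..N}; strict_mono_on {1..n} g\<rbrakk>
      \<Longrightarrow> (n, pullback n g \<chi>) \<in> X"
begin

lemma finite_level: "finite (level X n)"
proof (rule finite_subset)
  show "level X n \<subseteq> {n} \<times> (nsets {1..n} 2 \<rightarrow>\<^sub>E P)"
    using graphs by (auto simp: level_def colored_graphs_def)
  show "finite ({n} \<times> (nsets {1..n} 2 \<rightarrow>\<^sub>E P))"
    using finite_colors by (simp add: finite_PiE finite_imp_finite_nsets)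
qed

lemma coloring: "(N, \<chi>) \<in> X \<Longrightarrow> \<chi> \<in> nsets {1..N} 2 \<rightarrow>\<^sub>E P"
  using graphs by (auto simp: colored_graphs_def)

lemma color_in:
  assumes "(N, \<chi>) \<in> X" "u \<in> {1..N}" "v \<in> {1..N}" "u \<noteq> v"
  shows "\<chi> {u, v} \<in> P"
proof -
  have "{u, v} \<in> nsets {1..N} 2"
    using assms by (auto simp: nsets_def)
  then show ?thesis
    by (rule PiE_mem[OF coloring[OF assms(1)]])
qed

text \<open>Source of all contradictions below: one large graph is pulled back along the embeddings
  \<open>g i\<close>, and the results differ pairwise because some edge tells any two of them
  apart.\<close>

lemma card_level_ge:
  assumes "(N, \<chi>) \<in> X"
    and "\<And>i k. i \<in> I \<Longrightarrow> k \<in> {1..n} \<Longrightarrow> g i k \<in> {1..N}"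
    and "\<And>i k l. i \<in> I \<Longrightarrow> 1 \<le> k \<Longrightarrow> k < l \<Longrightarrow> l \<le> n \<Longrightarrow> g i k < g i l"
    and "\<And>i j. i \<in> I \<Longrightarrow> j \<in> I \<Longrightarrow> i < j \<Longrightarrow>
      \<exists>k l. 1 \<le> k \<and> k < l \<and> l \<le> n \<and> \<chi> {g i k, g i l} \<noteq> \<chi> {g j k, g j l}"
  shows "card (I :: nat set) \<le> card (level X n)"
proof (rule card_inj_on_le)
  let ?F = "\<lambda>i. (n, pullback n (g i) \<chi>)"
  have "?F i \<noteq> ?F j" if ij: "i \<in> I" "j \<in> I" "i < j" for i j
  proof -
    obtain k l where "1 \<le> k" "k < l" "l \<le> n" "\<chi> {g i k, g i l} \<noteq> \<chi> {g j k, g j l}"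
      using assms(4)[OF ij] by blast
    then have "pullback n (g i) \<chi> {k, l} \<noteq> pullback n (g j) \<chi> {k, l}"
      by (simp add: pullback_edge)
    then show ?thesis
      by auto
  qed
  then show "inj_on ?F I"
    by (intro linorder_inj_onI') auto
  show "?F ` I \<subseteq> level X n"
  proof clarify
    fix i assume "i \<in> I"
    then have "g i \<in> {1..n} \<rightarrow> {1..N}" "strict_mono_on {1..n} (g i)"
      using assms(2,3) by (auto simp: strict_mono_on_def)
    then show "?F i \<in> level X n"
      using hereditary[OF assms(1)] by (simp add: level_def)
  qed
qed (rule finite_level)

end

section \<open>A small level forbids color switches\<close>

locale small_class = hereditary_class +
  fixes n :: nat
  assumes small: "card (level X n) < n"
begin

text \<open>If \<open>t\<close> had another color towards \<open>u\<close>, the position of the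
  first edge at \<open>u\<close> not colored \<alpha> could be chosen freely, which gives
  \<open>n\<close> subgraphs on \<open>n\<close> vertices.\<close>

lemma no_right_switch:
  assumes G: "(N, \<chi>) \<in> X" and "1 \<le> u" and S: "S \<subseteq> {u<..<t}" "n \<le> card S"
    and const: "\<And>v. v \<in> S \<Longrightarrow> \<chi> {u, v} = \<alpha>" and "t + n \<le> N"
  shows "\<chi> {u, t} = \<alpha>"
proof (rule ccontr)
  assume ne: "\<chi> {u, t} \<noteq> \<alpha>"
  have "finite S"
    using S(1) finite_subset by blast
  then obtain h where h: "\<And>k. k < n \<Longrightarrow> h k \<in> S" "\<And>k l. k < l \<Longrightarrow> l < n \<Longrightarrow> h k < h l"
    using S(2) by (rule strict_mono_enumeration) blast
  have h': "u < h k" "h k < t" if "k < n" for k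
    using h(1)[OF that] S(1) by auto
  \<comment> \<open>Position 1 is \<open>u\<close>, positions 2 to \<open>i\<close> are filled from
    \<open>S\<close>, and \<open>t\<close> sits at \<open>i + 1\<close>, followed by consecutive
    vertices, for which \<open>t + n \<le> N\<close> leaves room. For \<open>i = n\<close> the
    vertex \<open>t\<close> is absent.\<close>
  define g where "g i k = (if k = 1 then u else if k \<le> i then h (k - 1) else t + k - i - 1)" for i k
  \<comment> \<open>\<open>small\<close> excludes \<open>n = 0\<close>, so \<open>h 0\<close> exists
    and lies between \<open>u\<close> and \<open>t\<close>.\<close>
  have "u < t"
    using h'[of 0] small by (cases n) auto
  have "card {1..n} \<le> card (level X n)"
  proof (rule card_level_ge[OF G, of _ _ g])
    fix i k assume ik: "i \<in> {1..n}" "k \<in> {1..n}"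
    then have "u < h (k - 1)" "h (k - 1) < t"
      using h'[of "k - 1"] by auto
    then show "g i k \<in> {1..N}"
      using ik \<open>1 \<le> u\<close> \<open>t + n \<le> N\<close> by (auto simp: g_def)
  next
    fix i k l assume "i \<in> {1..n}" "1 \<le> k" "k < l" "l \<le> n"
    then have "u < h (k - 1)" "h (k - 1) < t" "u < h (l - 1)" "k = 1 \<or> h (k - 1) < h (l - 1)"
      using h'[of "k - 1"] h'[of "l - 1"] h(2)[of "k - 1" "l - 1"] by auto
    then show "g i k < g i l"
      using \<open>1 \<le> k\<close> \<open>k < l\<close> \<open>u < t\<close> by (auto simp: g_def)
  next
    fix i j assume "i \<in> {1..n}" "j \<in> {1..n}" "i < j"
    then have "\<chi> {g i 1, g i (i + 1)} \<noteq> \<chi> {g j 1, g j (i + 1)}"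
      using ne const h(1)[of i] by (auto simp: g_def)
    then show "\<exists>k l. 1 \<le> k \<and> k < l \<and> l \<le> n \<and> \<chi> {g i k, g i l} \<noteq> \<chi> {g j k, g j l}"
      using \<open>i \<in> {1..n}\<close> \<open>j \<in> {1..n}\<close> \<open>i < j\<close> by (intro exI[of _ 1] exI[of _ "i + 1"]) auto
  qed
  then show False
    using small by simp
qed

lemma no_left_switch:
  assumes G: "(N, \<chi>) \<in> X" and "u \<le> N" and S: "S \<subseteq> {t<..<u}" "n \<le> card S"
    and const: "\<And>v. v \<in> S \<Longrightarrow> \<chi> {v, u} = \<alpha>" and "n \<le> t"
  shows "\<chi> {t, u} = \<alpha>"
proof (rule ccontr)
  assume ne: "\<chi> {t, u} \<noteq> \<alpha>"
  have "finite S"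
    using S(1) finite_subset by blast
  then obtain h where h: "\<And>k. k < n \<Longrightarrow> h k \<in> S" "\<And>k l. k < l \<Longrightarrow> l < n \<Longrightarrow> h k < h l"
    using S(2) by (rule strict_mono_enumeration) blast
  have h': "t < h k" "h k < u" if "k < n" for k
    using h(1)[OF that] S(1) by auto
  \<comment> \<open>Mirror image: \<open>u\<close> is last, \<open>t\<close> sits at position
    \<open>i\<close> with consecutive vertices before it, and the positions between are filled from
    \<open>S\<close>. For \<open>i = 0\<close> the vertex \<open>t\<close> is absent.\<close>
  define g where "g i k = (if k = n then u else if k > i then h k else t + k - i)" for i k
  have "t < u"
    using h'[of 0] small by (cases n) auto
  have "card {0..<n} \<le> card (level X n)"
  proof (rule card_level_ge[OF G, of _ _ g])
    fix i k assume "i \<in> {0..<n}" "k \<in> {1..n}"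
    then show "g i k \<in> {1..N}"
      using \<open>u \<le> N\<close> \<open>n \<le> t\<close> \<open>t < u\<close> h'[of k] by (auto simp: g_def)
  next
    fix i k l assume "i \<in> {0..<n}" "1 \<le> k" "k < l" "l \<le> n"
    then show "g i k < g i l"
      using \<open>t < u\<close> \<open>n \<le> t\<close> h'[of k] h'[of l] h(2)[of k l] by (auto simp: g_def)
  next
    fix i j assume "i \<in> {0..<n}" "j \<in> {0..<n}" "i < j"
    then have "\<chi> {g i j, g i n} \<noteq> \<chi> {g j j, g j n}"
      using ne const h(1)[of j] by (auto simp: g_def)
    then show "\<exists>k l. 1 \<le> k \<and> k < l \<and> l \<le> n \<and> \<chi> {g i k, g i l} \<noteq> \<chi> {g j k, g j l}"
      using \<open>j \<in> {0..<n}\<close> \<open>i < j\<close> by (intro exI[of _ j] exI[of _ n]) auto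
  qed
  then show False
    using small by simp
qed

section \<open>Pigeonhole and the color of long edges\<close>

definition K :: nat where "K = card P * n"

text \<open>If all \<open>card P\<close> color classes had fewer than \<open>n\<close> elements,
  \<open>D\<close> would have fewer than \<open>K\<close>. That \<open>D\<close> is nonempty makes
  \<open>P\<close> nonempty, so that the comparison of sums is strict.\<close>

lemma frequent_color:
  assumes G: "(N, \<chi>) \<in> X" and "u \<in> {1..N}" "D \<subseteq> {1..N}" "u \<notin> D" "card D = K" "D \<noteq> {}"
  obtains \<alpha> where "n \<le> card {v \<in> D. \<chi> {u, v} = \<alpha>}"
proof (rule ccontr)
  assume "\<not> thesis"
  then have less: "card {v \<in> D. \<chi> {u, v} = \<alpha>} < n" for \<alpha>
    using that by (meson not_le)
  have D: "finite D"
    using assms(3) finite_subset by blast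
  have sub: "(\<lambda>v. \<chi> {u, v}) ` D \<subseteq> P"
    using assms color_in[OF G] by blast
  then have "P \<noteq> {}"
    using \<open>D \<noteq> {}\<close> by blast
  have "card D \<le> card (\<Union>\<alpha>\<in>P. {v \<in> D. \<chi> {u, v} = \<alpha>})"
    using sub D finite_colors by (intro card_mono) auto
  also have "\<dots> \<le> (\<Sum>\<alpha>\<in>P. card {v \<in> D. \<chi> {u, v} = \<alpha>})"
    using finite_colors by (rule card_UN_le)
  also have "\<dots> < (\<Sum>\<alpha>\<in>P. n)"
    using finite_colors \<open>P \<noteq> {}\<close> less by (intro sum_strict_mono) auto
  also have "\<dots> = K"
    by (simp add: K_def)
  finally show False
    using \<open>card D = K\<close> by simp
qed

lemma K_pos:
  assumes "(N, \<chi>) \<in> X" "2 \<le> N"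
  shows "0 < K"
proof -
  have "\<chi> {1, 2} \<in> P"
    using assms by (intro color_in) auto
  then show ?thesis
    using finite_colors small by (auto simp: K_def card_gt_0_iff)
qed

text \<open>A color frequent among the \<open>K\<close> vertices just after \<open>u\<close> is
  forced on every later admissible vertex by \<open>no_right_switch\<close>.\<close>

lemma right_const:
  assumes G: "(N, \<chi>) \<in> X" and "1 \<le> u" "u + K < t" "t + n \<le> N" "u + K < t'" "t' + n \<le> N"
  shows "\<chi> {u, t} = \<chi> {u, t'}"
proof -
  have "0 < K"
    using assms by (intro K_pos[OF G]) auto
  then have "u \<in> {1..N}" "{u<..u + K} \<subseteq> {1..N}" "u \<notin> {u<..u + K}" "card {u<..u + K} = K" "{u<..u + K} \<noteq> {}"
    using assms by auto
  then obtain \<alpha> where \<alpha>: "n \<le> card {v \<in> {u<..u + K}. \<chi> {u, v} = \<alpha>}"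
    by (rule frequent_color[OF G])
  have "\<chi> {u, s} = \<alpha>" if "u + K < s" "s + n \<le> N" for s
    by (rule no_right_switch[OF G \<open>1 \<le> u\<close> _ \<alpha> _ that(2)]) (use that(1) in auto)
  then show ?thesis
    using assms by simp
qed

lemma left_const:
  assumes G: "(N, \<chi>) \<in> X" and "u \<le> N" "t + K < u" "n \<le> t" "t' + K < u" "n \<le> t'"
  shows "\<chi> {t, u} = \<chi> {t', u}"
proof -
  have "1 \<le> n"
    using small by simp
  then have "0 < K"
    using assms by (intro K_pos[OF G]) auto
  then have "u \<in> {1..N}" "{u - K..<u} \<subseteq> {1..N}" "u \<notin> {u - K..<u}" "card {u - K..<u} = K" "{u - K..<u} \<noteq> {}"
    using assms \<open>1 \<le> n\<close> by auto
  then obtain \<alpha> where \<alpha>: "n \<le> card {v \<in> {u - K..<u}. \<chi> {u, v} = \<alpha>}"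
    by (rule frequent_color[OF G])
  have "\<chi> {s, u} = \<alpha>" if "s + K < u" "n \<le> s" for s
    by (rule no_left_switch[OF G \<open>u \<le> N\<close> _ \<alpha> _ that(2)]) (use that(1) in \<open>auto simp: insert_commute\<close>)
  then show ?thesis
    using assms by simp
qed

text \<open>The right end slides to \<open>N - n\<close>, then the left end to \<open>n\<close>; the
  distance exceeds \<open>K\<close> throughout. The resulting color may vary with the graph, but not
  with \<open>u\<close> and \<open>v\<close>.\<close>

lemma far_const:
  assumes G: "(N, \<chi>) \<in> X" and "n \<le> u" "u + K < v" "v + n \<le> N"
  shows "\<chi> {u, v} = \<chi> {n, N - n}"
proof -
  have "1 \<le> n"
    using small by simp
  then have "\<chi> {u, v} = \<chi> {u, N - n}"
    using assms by (intro right_const[OF G]) auto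
  also have "\<dots> = \<chi> {n, N - n}"
    using assms by (intro left_const[OF G]) auto
  finally show ?thesis .
qed

section \<open>Short edges in the middle\<close>

definition L :: nat where "L = n + n * Suc K"

text \<open>An exceptional edge \<open>{x, y}\<close> could be preceded by any number below
  \<open>n\<close> of sparse vertices, among which and towards \<open>x\<close> all edges have the
  reference color. Its position then distinguishes \<open>n\<close> subgraphs.\<close>

lemma middle_const:
  assumes G: "(N, \<chi>) \<in> X" and "L \<le> x" "x < y" "y + n \<le> N"
  shows "\<chi> {x, y} = \<chi> {n, N - n}"
proof (rule ccontr)
  let ?c = "\<chi> {n, N - n}"
  assume ne: "\<chi> {x, y} \<noteq> ?c"
  have "1 \<le> n"
    using small by simp
  define a where "a k = n + (k - 1) * Suc K" for k
  have a_less: "a k + K < a l" if "1 \<le> k" "k < l" for k l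
  proof -
    have "Suc (k - 1) * Suc K \<le> (l - 1) * Suc K"
      using that by (intro mult_le_mono1) auto
    then show ?thesis
      by (simp add: a_def)
  qed
  \<comment> \<open>The next term of the sequence, \<open>a (Suc n)\<close>, equals
    \<open>L\<close>.\<close>
  have a_x: "a k + K < x" if "1 \<le> k" "k \<le> n" for k
    using that a_less[of k "Suc n"] \<open>L \<le> x\<close> by (simp add: a_def L_def)
  have a_ge: "n \<le> a k" for k
    by (simp add: a_def)
  have aa: "\<chi> {a k, a l} = ?c" if "1 \<le> k" "k < l" "l \<le> n" for k l
    using that a_less[of k l] a_x[of l] a_ge assms by (intro far_const[OF G]) auto
  have ax: "\<chi> {a k, x} = ?c" if "1 \<le> k" "k \<le> n" for k
    using that a_x[of k] a_ge assms by (intro far_const[OF G]) auto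
  \<comment> \<open>The exceptional edge occupies positions \<open>i + 1\<close> and
    \<open>i + 2\<close>; for \<open>i = n - 1\<close> only \<open>x\<close> still fits.\<close>
  define g where "g i k = (if k \<le> i then a k else if k = i + 1 then x else y + k - i - 2)" for i k
  have "card {0..<n} \<le> card (level X n)"
  proof (rule card_level_ge[OF G, of _ _ g])
    fix i k assume "i \<in> {0..<n}" "k \<in> {1..n}"
    then show "g i k \<in> {1..N}"
      using a_x[of k] a_ge[of k] \<open>1 \<le> n\<close> assms by (auto simp: g_def L_def)
  next
    fix i k l assume "i \<in> {0..<n}" "1 \<le> k" "k < l" "l \<le> n"
    then show "g i k < g i l"
      using a_less[of k l] a_x[of k] \<open>x < y\<close> by (auto simp: g_def)
  next
    fix i j assume ij: "i \<in> {0..<n}" "j \<in> {0..<n}" "i < j"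
    have "\<chi> {g i (i + 1), g i (i + 2)} = \<chi> {x, y}"
      by (simp add: g_def)
    \<comment> \<open>Both positions hold sparse vertices, except that for \<open>j = i + 1\<close>
      the second one is already \<open>x\<close>.\<close>
    moreover have "\<chi> {g j (i + 1), g j (i + 2)} = ?c"
      using ij aa[of "i + 1" "i + 2"] ax[of "i + 1"] by (cases "j = i + 1") (auto simp: g_def)
    ultimately show "\<exists>k l. 1 \<le> k \<and> k < l \<and> l \<le> n \<and> \<chi> {g i k, g i l} \<noteq> \<chi> {g j k, g j l}"
      using ne ij by (intro exI[of _ "i + 1"] exI[of _ "i + 2"]) auto
  qed
  then show False
    using small by simp
qed

section \<open>Deleting a middle vertex\<close>

definition m :: nat where "m = L + K + 1"

text \<open>A vertex \<open>u\<close> within distance \<open>K\<close> of \<open>m\<close> is beyond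
  \<open>L\<close>, so \<open>middle_const\<close> applies; a more distant one, even near the left
  end, falls under \<open>right_const\<close>. The substitute \<open>m + 1\<close> cannot coincide
  with \<open>u\<close>.\<close>

lemma twin_right:
  assumes G: "(N, \<chi>) \<in> X" and "m + 1 + n \<le> N" "1 \<le> u" "u < m"
  shows "\<chi> {u, m} = \<chi> {u, m + 1}"
proof (cases "u + K < m")
  case True
  then show ?thesis
    using assms by (intro right_const[OF G]) auto
next
  case False
  then show ?thesis
    using assms middle_const[OF G, of u m] middle_const[OF G, of u "m + 1"] by (simp add: m_def)
qed

text \<open>For \<open>u\<close> on the right the substitute is \<open>m - 1\<close>, again distinct
  from \<open>u\<close>, and still at least \<open>L\<close>.\<close>

lemma twin_left:
  assumes G: "(N, \<chi>) \<in> X" and "m + K + n \<le> N" "m < u" "u \<le> N"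
  shows "\<chi> {m, u} = \<chi> {m - 1, u}"
proof (cases "m + K < u")
  case True
  then show ?thesis
    using assms by (intro left_const[OF G]) (auto simp: m_def L_def)
next
  case False
  then show ?thesis
    using assms middle_const[OF G, of m u] middle_const[OF G, of "m - 1" u] by (simp add: m_def)
qed

text \<open>Deleting \<open>m\<close> loses no information: edges avoiding \<open>m\<close> survive,
  and each edge at \<open>m\<close> has the color of a surviving edge at a neighbor of
  \<open>m\<close>.\<close>

lemma card_level_Suc_le:
  assumes "m + K + n + 1 \<le> N"
  shows "card (level X (Suc N)) \<le> card (level X N)"
proof (rule card_inj_on_le)
  define g where "g k = (if k < m then k else Suc k)" for k
  let ?F = "\<lambda>(M :: nat, \<chi> :: nat set \<Rightarrow> 'a). (N, pullback N g \<chi>)"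
  have g: "g \<in> {1..N} \<rightarrow> {1..Suc N}" "strict_mono_on {1..N} g"
    by (auto simp: g_def strict_mono_on_def)
  show "?F ` level X (Suc N) \<subseteq> level X N"
    using hereditary[OF _ g] by (auto simp: level_def)
  show "inj_on ?F (level X (Suc N))"
  proof (rule inj_onI)
    fix A B assume A: "A \<in> level X (Suc N)" and B: "B \<in> level X (Suc N)" and eq: "?F A = ?F B"
    obtain \<chi> \<psi> where AB: "A = (Suc N, \<chi>)" "B = (Suc N, \<psi>)"
      using A B by (cases A; cases B) (auto simp: level_def)
    have X: "(Suc N, \<chi>) \<in> X" "(Suc N, \<psi>) \<in> X"
      using A B AB by (auto simp: level_def)
    have avoid: "\<chi> {i, j} = \<psi> {i, j}" if "1 \<le> i" "i < j" "j \<le> Suc N" "i \<noteq> m" "j \<noteq> m" for i j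
    proof -
      \<comment> \<open>\<open>d\<close> inverts \<open>g\<close> on the vertices other than
        \<open>m\<close>.\<close>
      define d where "d k = (if k < m then k else k - 1)" for k
      have "1 \<le> d i" "d i < d j" "d j \<le> N" "g (d i) = i" "g (d j) = j"
        using that assms by (auto simp: d_def g_def m_def)
      then show ?thesis
        using eq AB pullback_edge[of "d i" "d j" N g] by (metis (no_types, lifting) case_prod_conv prod.inject)
    qed
    have "\<chi> e = \<psi> e" for e
    proof (cases "e \<in> nsets {1..Suc N} 2")
      case True
      then obtain i j where ij: "1 \<le> i" "i < j" "j \<le> Suc N" "e = {i, j}"
        by (rule edges_cases)
      consider "i = m" | "j = m" | "i \<noteq> m" "j \<noteq> m"
        by blast
      then show ?thesis
      proof cases
        case 1
        then show ?thesis
          \<comment> \<open>\<open>small\<close> gives \<open>n > 0\<close>, hence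
            \<open>m - 1\<close> is at least 1 and is a vertex.\<close>
          using ij assms twin_left[OF X(1), of j] twin_left[OF X(2), of j] avoid[of "m - 1" j]
            small by (simp add: m_def L_def)
      next
        case 2
        then show ?thesis
          using ij assms twin_right[OF X(1), of i] twin_right[OF X(2), of i] avoid[of i "m + 1"]
          by simp
      next
        case 3
        then show ?thesis
          using ij avoid by simp
      qed
    next
      case False
      then show ?thesis
        using PiE_arb[OF coloring[OF X(1)]] PiE_arb[OF coloring[OF X(2)]] by simp
    qed
    then have "\<chi> = \<psi>"
      by (rule ext)
    then show "A = B"
      using AB by simp
  qed
qed (rule finite_level)

lemma card_level_eventually_const: "\<exists>n0 d. \<forall>N > n0. card (level X N) = d"
  using card_level_Suc_le by (rule antimono_nat_eventually_const)

end

text \<open>The map \<open>g\<close> itself witnesses containment: colors agree along it, and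
  \<open>r\<close> is reflexive on \<open>P\<close>.\<close>

lemma graph_ideal_hereditary_class:
  assumes "finite P" "partial_order_on P r" "graph_ideal P r X"
  shows "hereditary_class P X"
proof
  show "finite P" by fact
  show X: "X \<subseteq> colored_graphs P"
    using assms(3) by (simp add: graph_ideal_def)
  fix N \<chi> g and n :: nat assume *: "(N, \<chi>) \<in> X" "g \<in> {1..n} \<rightarrow> {1..N}" "strict_mono_on {1..n} g"
  have refl: "refl_on P r"
    using assms(2) by (simp add: partial_order_on_def preorder_on_def)
  have pb: "(n, pullback n g \<chi>) \<in> colored_graphs P"
    using X * by (blast intro: pullback_in_colored_graphs)
  have "(pullback n g \<chi> {i, j}, \<chi> {g i, g j}) \<in> r" if "1 \<le> i" "i < j" "j \<le> n" for i j
  proof -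
    have "{i, j} \<in> nsets {1..n} 2"
      using that by (auto simp: nsets_def)
    then have "pullback n g \<chi> {i, j} \<in> P"
      using pb by (auto simp: colored_graphs_def)
    then have "(pullback n g \<chi> {i, j}, pullback n g \<chi> {i, j}) \<in> r"
      by (rule refl_onD[OF refl])
    then show ?thesis
      by (simp only: pullback_edge[OF that])
  qed
  then have "contained r (n, pullback n g \<chi>) (N, \<chi>)"
    using * by (auto simp: contained_def)
  then show "(n, pullback n g \<chi>) \<in> X"
    using assms(3) pb *(1) by (auto simp: graph_ideal_def)
qed

theorem theorem3p1:
  fixes P :: "'a set" and r :: "('a \<times> 'a) set" and X :: "'a colored_graph set"
  assumes "finite P" and "partial_order_on P r" and "graph_ideal P r X"
  shows "(\<exists>n0 d :: nat. \<forall>n > n0. card (level X n) = d) \<or>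
         (\<forall>n \<ge> 1. card (level X n) \<ge> n)"
proof (rule disjCI)
  assume "\<not> (\<forall>n \<ge> 1. card (level X n) \<ge> n)"
  then obtain n where "card (level X n) < n"
    by (meson not_le)
  then have "small_class P X n"
    using graph_ideal_hereditary_class[OF assms]
    by (simp add: small_class_def small_class_axioms_def)
  then show "\<exists>n0 d. \<forall>n > n0. card (level X n) = d"
    by (rule small_class.card_level_eventually_const)
qed

end
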